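(* Let $G=(V,E)$ be a graph, let $k\in\mathbb{R}_+$, and let $w\in\mathbb{R}_+^V$. Then $$\varphi_k(G,w)\leq\theta_k(G,w).$$
   Context: $A_G$ is the adjacency matrix of the graph $G=(V,E)$. $\mathbb{R}_+$ is the set of nonnegative reals, $\mathbb{S}^V_+$ is the set of positive semidefinite real symmetric $V\times V$ matrices, $I$ is the identity matrix, $\circ$ is the entrywise product, $\langle A,B\rangle=\operatorname{trace}(AB)$ for matrices and $\langle w,x\rangle=w^\top x$ for vectors, $\operatorname{diag}(Y)$ is the vector of diagonal entries of $Y$, and $A\preceq B$ means that $B-A$ is positive semidefinite. For nonnegative real $k$ and $w\in\mathbb{R}_+^V$, $$\varphi_k(G,w)=\max\{\langle M,Y\rangle : M,Y\in\mathbb{S}^V_+,\ \operatorname{diag}(Y)=w,\ A_G\circ Y=0,\ \langle I,M\rangle=k,\ M\preceq I\}.$$ The theta body $\mathrm{TH}(G)$ is the set of $x\in\mathbb{R}^V$ for which there exists a real symmetric $V\times V$ matrix $Y$ with $\operatorname{diag}(Y)=x$, $A_G\circ Y=0$, and $\begin{pmatrix}1&x^\top\\ x&Y\end{pmatrix}$ positive semidefinite. For nonnegative real $k$ and $w\in\mathbb{R}_+^V$, $$\mathrm{TH}_k(G)=k\,\mathrm{TH}(G)\cap[0,1]^V,\qquad\theta_k(G,w)=\max\{\langle w,x\rangle : x\in\mathrm{TH}_k(G)\}.$$ *)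

theory Defs
  imports "HOL-Analysis.Analysis"
begin

text \<open>
  A graph is finite and simple. Its vertex set is the whole of a finite type \<open>'v\<close>, and it is given
  by its set of edges, which are two-element sets of vertices.
\<close>

definition simple_graph :: "'v::finite set set \<Rightarrow> bool" where
  "simple_graph E \<longleftrightarrow> (\<forall>e\<in>E. card e = 2)"

definition adjacency :: "'v::finite set set \<Rightarrow> real^'v^'v" where
  "adjacency E = (\<chi> i j. if {i, j} \<in> E then 1 else 0)"

definition psd :: "real^'n^'n \<Rightarrow> bool" where
  "psd A \<longleftrightarrow> transpose A = A \<and> (\<forall>x. 0 \<le> x \<bullet> (A *v x))"

definition loewner_le :: "real^'n^'n \<Rightarrow> real^'n^'n \<Rightarrow> bool" (infix "\<preceq>" 50) where
  "A \<preceq> B \<longleftrightarrow> psd (B - A)"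

definition diagonal :: "real^'n^'n \<Rightarrow> real^'n" where
  "diagonal Y = (\<chi> i. Y $ i $ i)"

text \<open>
  The matrix with rows \<open>(1, x\<^sup>T)\<close> and \<open>(x, Y)\<close>; the additional index is \<open>None\<close>.
\<close>

definition bordered :: "real^'v \<Rightarrow> real^'v^'v \<Rightarrow> real^('v option)^('v option)" where
  "bordered x Y = (\<chi> a b. case a of
       None \<Rightarrow> (case b of None \<Rightarrow> 1 | Some j \<Rightarrow> x $ j)
     | Some i \<Rightarrow> (case b of None \<Rightarrow> x $ i | Some j \<Rightarrow> Y $ i $ j))"

text \<open>
  On the type \<^typ>\<open>real^'v^'v\<close> the operation \<open>*\<close> is the entrywise product, \<open>**\<close> is the matrix
  product, and \<open>mat 1\<close> is the identity matrix.

  Maxima are taken in \<^typ>\<open>ereal\<close>, so that the maximum over the empty set is \<open>-\<infinity>\<close>. This concerns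
  only \<open>phi\<close>, whose feasible set is empty exactly when \<open>k\<close> exceeds the number of vertices (for
  nonnegative \<open>k\<close> and \<open>w\<close>). In all other cases the suprema are attained, as shown below.
\<close>

definition phi_feasible ::
    "real \<Rightarrow> 'v::finite set set \<Rightarrow> real^'v \<Rightarrow> ((real^'v^'v) \<times> (real^'v^'v)) set" where
  "phi_feasible k E w = {(M, Y). psd M \<and> psd Y \<and> diagonal Y = w \<and> adjacency E * Y = 0
      \<and> trace (mat 1 ** M) = k \<and> M \<preceq> mat 1}"

definition phi :: "real \<Rightarrow> 'v::finite set set \<Rightarrow> real^'v \<Rightarrow> ereal" where
  "phi k E w = (SUP (M, Y) \<in> phi_feasible k E w. ereal (trace (M ** Y)))"

definition TH :: "'v::finite set set \<Rightarrow> (real^'v) set" where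
  "TH E = {x. \<exists>Y. transpose Y = Y \<and> diagonal Y = x \<and> adjacency E * Y = 0 \<and> psd (bordered x Y)}"

definition TH_k :: "real \<Rightarrow> 'v::finite set set \<Rightarrow> (real^'v) set" where
  "TH_k k E = (\<lambda>x. k *\<^sub>R x) ` TH E \<inter> {x. \<forall>i. x $ i \<in> {0..1}}"

definition theta :: "real \<Rightarrow> 'v::finite set set \<Rightarrow> real^'v \<Rightarrow> ereal" where
  "theta k E w = (SUP x \<in> TH_k k E. ereal (w \<bullet> x))"


lemma closed_psd: "closed {A::real^'n^'n. psd A}"
proof -
  have "{A::real^'n^'n. psd A} =
      {A. (\<forall>i j. A $ i $ j = A $ j $ i) \<and> (\<forall>x. 0 \<le> (\<Sum>i\<in>UNIV. x $ i * (\<Sum>j\<in>UNIV. A $ i $ j * x $ j)))}"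
    unfolding psd_def
    by (auto simp: transpose_def vec_eq_iff inner_vec_def matrix_vector_mult_def)
  also have "closed \<dots>"
    by (intro closed_Collect_conj closed_Collect_all closed_Collect_eq closed_Collect_le continuous_intros)
  finally show ?thesis .
qed

lemma axis_quadratic_form: "axis i a \<bullet> (A *v axis j b) = a * b * A $ i $ j" for A :: "real^'n^'n"
proof -
  have "(\<Sum>l\<in>UNIV. A $ i $ l * axis j b $ l) = (\<Sum>l\<in>UNIV. if l = j then A $ i $ l * b else 0)"
    by (intro sum.cong) (auto simp: axis_def)
  then show ?thesis by (simp add: inner_axis' matrix_vector_mult_def)
qed

lemma quadratic_form_two:
  fixes A :: "real^'n^'n"
  shows "(axis i a + axis j b) \<bullet> (A *v (axis i a + axis j b))
     = a * a * A $ i $ i + a * b * (A $ i $ j + A $ j $ i) + b * b * A $ j $ j"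
  by (simp only: matrix_vector_right_distrib inner_add_left inner_add_right axis_quadratic_form)
     (simp add: algebra_simps)

lemma psd_sym: "psd A \<Longrightarrow> A $ i $ j = A $ j $ i"
  unfolding psd_def by (metis transpose_def vec_lambda_beta)

lemma psd_diag: "psd A \<Longrightarrow> 0 \<le> A $ i $ i"
proof -
  assume "psd A"
  then have "0 \<le> axis i 1 \<bullet> (A *v axis i 1)" by (simp add: psd_def)
  then show ?thesis by (simp add: axis_quadratic_form)
qed

lemma psd_two:
  assumes "psd A"
  shows "0 \<le> a * a * A $ i $ i + 2 * a * b * A $ i $ j + b * b * A $ j $ j"
proof -
  have "0 \<le> (axis i a + axis j b) \<bullet> (A *v (axis i a + axis j b))"
    using assms by (simp add: psd_def)
  then show ?thesis
    unfolding quadratic_form_two psd_sym[OF assms, of j i] by simp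
qed

lemma psd_entry_bound:
  assumes "psd A" "\<And>i. A $ i $ i \<le> c"
  shows "\<bar>A $ i $ j\<bar> \<le> c"
  using psd_two[OF assms(1), of 1 i 1 j] psd_two[OF assms(1), of 1 i "-1" j]
    assms(2)[of i] assms(2)[of j] by simp

lemma matrix_norm_bound:
  fixes A :: "real^'n^'n"
  assumes "\<And>i j. \<bar>A $ i $ j\<bar> \<le> c"
  shows "norm A \<le> of_nat CARD('n) * (of_nat CARD('n) * c)"
proof -
  have "norm (A $ i) \<le> of_nat CARD('n) * c" for i
    using norm_le_l1_cart[of "A $ i"] sum_bounded_above[of UNIV "\<lambda>j. \<bar>A $ i $ j\<bar>" c] assms
    by fastforce
  moreover have "norm A \<le> (\<Sum>i\<in>UNIV. norm (A $ i))"
    unfolding norm_vec_def[of A] by (rule L2_set_le_sum) simp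
  ultimately show ?thesis
    using sum_bounded_above[of UNIV "\<lambda>i. norm (A $ i)" "of_nat CARD('n) * c"] by fastforce
qed

lemma compact_phi_feasible: "compact (phi_feasible k E w)"
proof -
  let ?c = "Max (range (\<lambda>i. w $ i))"
  define n where "n = real CARD('a)"
  have bound: "p \<in> cball 0 (n * (n * 1)) \<times> cball 0 (n * (n * ?c))"
    if feas: "p \<in> phi_feasible k E w" for p
  proof -
    obtain M Y where p: "p = (M, Y)" by (cases p)
    with feas have h: "psd M" "psd Y" "diagonal Y = w" "psd (mat 1 - M)"
      by (auto simp: phi_feasible_def loewner_le_def)
    have "M $ i $ i \<le> 1" for i
      using psd_diag[OF h(4), of i] by (simp add: mat_def)
    then have "norm M \<le> n * (n * 1)"
      unfolding n_def by (intro matrix_norm_bound psd_entry_bound[OF h(1)])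
    moreover have "Y $ i $ i \<le> ?c" for i
      using h(3) by (auto simp: diagonal_def vec_eq_iff)
    then have "norm Y \<le> n * (n * ?c)"
      unfolding n_def by (intro matrix_norm_bound psd_entry_bound[OF h(2)])
    ultimately show ?thesis by (simp add: p)
  qed
  have "bounded (phi_feasible k E w)"
    by (rule bounded_subset[OF bounded_Times[OF bounded_cball bounded_cball]]) (use bound in blast)
  moreover have "closed (phi_feasible k E w)"
  proof -
    have eq: "phi_feasible k E w =
       (fst -` {A. psd A}) \<inter> (snd -` {A. psd A}) \<inter> ((\<lambda>p. mat 1 - fst p) -` {A. psd A})
       \<inter> {p. (\<forall>i. snd p $ i $ i = w $ i) \<and> (\<forall>i j. adjacency E $ i $ j * snd p $ i $ j = 0)
            \<and> (\<Sum>i\<in>UNIV. fst p $ i $ i) = k}"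
      by (rule set_eqI)
        (simp add: phi_feasible_def loewner_le_def diagonal_def vec_eq_iff trace_def case_prod_beta conj_ac)
    show ?thesis
      unfolding eq
      by (intro closed_Int continuous_closed_vimage closed_psd closed_Collect_conj closed_Collect_all
          closed_Collect_eq continuous_intros)
  qed
  ultimately show ?thesis by (simp add: compact_eq_bounded_closed)
qed

lemma psd_diagonal_matrix:
  assumes "\<And>i. 0 \<le> d $ i"
  shows "psd (\<chi> i j. if i = j then d $ i else 0 :: real^'n^'n)"
  unfolding psd_def
proof (intro conjI allI)
  show "transpose (\<chi> i j. if i = j then d $ i else 0 :: real^'n^'n) = (\<chi> i j. if i = j then d $ i else 0)"
    by (auto simp: transpose_def vec_eq_iff)
  fix x :: "real^'n"
  have eq: "(\<Sum>j\<in>UNIV. (if i = j then d $ i else 0) * x $ j) = d $ i * x $ i" for i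
    by (simp add: if_distrib[of "\<lambda>c. c * _"] cong: if_cong)
  have "x \<bullet> ((\<chi> i j. if i = j then d $ i else 0) *v x) = (\<Sum>i\<in>UNIV. d $ i * (x $ i * x $ i))"
    by (simp add: inner_vec_def matrix_vector_mult_def eq mult.left_commute)
  also have "0 \<le> \<dots>" by (intro sum_nonneg mult_nonneg_nonneg[OF assms] zero_le_square)
  finally show "0 \<le> x \<bullet> ((\<chi> i j. if i = j then d $ i else 0) *v x)" .
qed

lemma phi_feasible_nonempty_iff:
  fixes k :: real and w :: "real^'v"
  assumes "simple_graph E" "0 \<le> k" "\<forall>i. 0 \<le> w $ i"
  shows "phi_feasible k E w \<noteq> {} \<longleftrightarrow> k \<le> CARD('v)"
proof
  assume "phi_feasible k E w \<noteq> {}"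
  then obtain M Y where h: "(M, Y) \<in> phi_feasible k E w" by auto
  then have "M $ i $ i \<le> 1" for i
    using psd_diag[of "mat 1 - M" i] by (simp add: phi_feasible_def loewner_le_def mat_def)
  then have "(\<Sum>i\<in>UNIV. M $ i $ i) \<le> of_nat CARD('v) * 1"
    by (intro sum_bounded_above) auto
  with h show "k \<le> CARD('v)" by (simp add: phi_feasible_def trace_def)
next
  assume k: "k \<le> CARD('v)"
  define c where "c = k / CARD('v)"
  have c: "0 \<le> c" "c \<le> 1" using k assms(2) by (auto simp: c_def)
  let ?M = "(\<chi> i j. if i = j then (\<chi> i. c) $ i else 0) :: real^'v^'v"
  let ?Y = "(\<chi> i j. if i = j then w $ i else 0) :: real^'v^'v"
  have "mat 1 - ?M = (\<chi> i j. if i = j then (\<chi> i. 1 - c) $ i else 0)"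
    by (auto simp: vec_eq_iff mat_def)
  then have "psd (mat 1 - ?M)"
    using psd_diagonal_matrix[of "\<chi> i. 1 - c"] c by simp
  moreover have "{i} \<notin> E" for i
    using assms(1) by (auto simp: simple_graph_def)
  then have "adjacency E * ?Y = 0"
    by (auto simp: vec_eq_iff adjacency_def)
  moreover have "(\<Sum>i\<in>UNIV. ?M $ i $ i) = k" by (simp add: c_def)
  ultimately have "(?M, ?Y) \<in> phi_feasible k E w"
    using psd_diagonal_matrix[of "\<chi> i. c"] psd_diagonal_matrix[of w] c assms(3)
    by (simp add: phi_feasible_def loewner_le_def diagonal_def trace_def)
  then show "phi_feasible k E w \<noteq> {}" by blast
qed

lemma phi_attained:
  fixes k :: real and w :: "real^'v"
  assumes "simple_graph E" "0 \<le> k" "k \<le> CARD('v)" "\<forall>i. 0 \<le> w $ i"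
  shows "\<exists>(M, Y) \<in> phi_feasible k E w. phi k E w = ereal (trace (M ** Y))"
proof -
  have ne: "phi_feasible k E w \<noteq> {}" using phi_feasible_nonempty_iff assms by blast
  have cont: "continuous_on (phi_feasible k E w) (\<lambda>p. trace (fst p ** snd p))"
    unfolding trace_def matrix_matrix_mult_def by (simp add: continuous_intros)
  obtain p where p: "p \<in> phi_feasible k E w"
    "\<And>q. q \<in> phi_feasible k E w \<Longrightarrow> trace (fst q ** snd q) \<le> trace (fst p ** snd p)"
    using continuous_attains_sup[OF compact_phi_feasible ne cont] by blast
  have "phi k E w = ereal (trace (fst p ** snd p))"
    unfolding phi_def case_prod_beta
    by (intro antisym SUP_least SUP_upper2[OF p(1)]) (simp_all add: p(2))
  then show ?thesis using p(1) by (auto simp: case_prod_beta)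
qed

lemma compact_TH: "compact (TH (E::'v::finite set set))"
proof -
  define T where "T = {Y::real^'v^'v. psd (bordered (diagonal Y) Y) \<and> adjacency E * Y = 0}"
  have sym: "transpose Y = Y" if "Y \<in> T" for Y
    using that psd_sym[of "bordered (diagonal Y) Y" "Some _" "Some _"]
    by (auto simp: T_def bordered_def transpose_def vec_eq_iff)
  have TH: "TH E = diagonal ` T"
    using sym by (auto simp: TH_def T_def)
  have "norm Y \<le> of_nat CARD('v) * (of_nat CARD('v) * 1)" if "Y \<in> T" for Y
  proof (rule matrix_norm_bound)
    fix i j
    have psd: "psd (bordered (diagonal Y) Y)" using that by (simp add: T_def)
    have "Y $ i $ i \<le> 1" for i
      using psd_two[OF psd, of "-1" None 1 "Some i"] by (simp add: bordered_def diagonal_def)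
    then have "bordered (diagonal Y) Y $ a $ a \<le> 1" for a
      by (cases a) (auto simp: bordered_def)
    then have "\<bar>bordered (diagonal Y) Y $ Some i $ Some j\<bar> \<le> 1"
      by (rule psd_entry_bound[OF psd])
    then show "\<bar>Y $ i $ j\<bar> \<le> 1" by (simp add: bordered_def)
  qed
  then have "bounded T" by (auto simp: bounded_iff)
  moreover have "closed T"
  proof -
    have cont: "continuous_on UNIV (\<lambda>Y::real^'v^'v. bordered (diagonal Y) Y)"
      unfolding bordered_def diagonal_def
    proof (intro continuous_on_vec_lambda)
      fix a b :: "'v option"
      show "continuous_on UNIV (\<lambda>Y::real^'v^'v. case a of
          None \<Rightarrow> (case b of None \<Rightarrow> 1 | Some j \<Rightarrow> (\<chi> i. Y $ i $ i) $ j)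
        | Some i \<Rightarrow> (case b of None \<Rightarrow> (\<chi> i. Y $ i $ i) $ i | Some j \<Rightarrow> Y $ i $ j))"
        by (cases a; cases b) (auto intro!: continuous_intros)
    qed
    have "T = ((\<lambda>Y. bordered (diagonal Y) Y) -` {A. psd A})
        \<inter> {Y. \<forall>i j. adjacency E $ i $ j * Y $ i $ j = 0}"
      by (auto simp: T_def vec_eq_iff simp del: mult_eq_0_iff)
    also have "closed \<dots>"
      by (intro closed_Int closed_Collect_all closed_Collect_eq continuous_intros
          closed_vimage[OF closed_psd cont])
    finally show ?thesis .
  qed
  ultimately have "compact T" by (simp add: compact_eq_bounded_closed)
  moreover have "continuous_on T diagonal"
    unfolding diagonal_def by (intro continuous_intros)
  ultimately show ?thesis unfolding TH by (rule compact_continuous_image[rotated])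
qed

lemma zero_in_TH: "0 \<in> TH (E :: 'v::finite set set)"
proof -
  have "bordered 0 (0 :: real^'v^'v) = (\<chi> a b. if a = b then (\<chi> a. if a = None then 1 else 0) $ a else 0)"
    by (auto simp: bordered_def vec_eq_iff split: option.split)
  moreover have "psd (\<chi> a b. if a = b then (\<chi> a. if a = None then 1 else 0) $ a else 0 :: real^('v option)^('v option))"
    by (rule psd_diagonal_matrix) simp
  ultimately have "psd (bordered 0 (0 :: real^'v^'v))" by simp
  then show ?thesis
    unfolding TH_def by (auto intro!: exI[of _ 0] simp: diagonal_def transpose_def vec_eq_iff)
qed

lemma theta_attained: "\<exists>x \<in> TH_k k E. theta k E w = ereal (w \<bullet> x)"
proof -
  have "closed {x::real^'a. \<forall>i. x $ i \<in> {0..1}}"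
    unfolding atLeastAtMost_iff
    by (intro closed_Collect_all closed_Collect_conj closed_Collect_le continuous_intros)
  then have "compact (TH_k k E)"
    unfolding TH_k_def by (intro compact_Int_closed compact_scaling compact_TH)
  moreover have "0 \<in> TH_k k E"
    using zero_in_TH[of E] by (force simp: TH_k_def)
  moreover have "continuous_on (TH_k k E) (\<lambda>x. w \<bullet> x)" by (intro continuous_intros)
  ultimately obtain x where x: "x \<in> TH_k k E" "\<And>y. y \<in> TH_k k E \<Longrightarrow> w \<bullet> y \<le> w \<bullet> x"
    using continuous_attains_sup[of "TH_k k E" "\<lambda>x. w \<bullet> x"] by blast
  have "theta k E w = ereal (w \<bullet> x)"
    unfolding theta_def by (intro antisym SUP_least SUP_upper2[OF x(1)]) (simp_all add: x(2))
  then show ?thesis using x(1) by blast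
qed

end

theory Submission
  imports Defs
begin

text \<open>
  Let \<open>(M, Y)\<close> be feasible for \<open>phi\<close>. The symmetric square root \<open>Z\<close> of \<open>Y\<close> has columns \<open>z\<^sub>i\<close> whose
  Gram matrix is \<open>Y\<close>, so \<open>z\<^sub>i\<close> has squared length \<open>w\<^sub>i\<close> and the columns of adjacent vertices are
  orthogonal. Normalising gives vectors \<open>u\<^sub>i\<close> of length one (or zero, where \<open>w\<^sub>i = 0\<close>), and the point
  with coordinates \<open>x\<^sub>i = u\<^sub>i\<^sup>T M u\<^sub>i\<close> does what is needed.

  Its value is \<open>\<Sum>\<^sub>i w\<^sub>i x\<^sub>i = \<Sum>\<^sub>i z\<^sub>i\<^sup>T M z\<^sub>i = trace (Z M Z) = trace (M Y)\<close>. A factorisation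
  \<open>Y = Z\<^sup>T Z\<close> alone would give \<open>trace (Z\<^sup>T M Z)\<close>; it is the symmetry of \<open>Z\<close> that turns this into the
  objective, and this is why a square root (\<open>psd_has_symmetric_sqrt\<close>) is constructed.

  Feasibility is \<open>orthogonal_representation_in_TH_k\<close>. The bound \<open>M \<preceq> I\<close> gives \<open>0 \<le> x\<^sub>i \<le> 1\<close>. Moreover, for
  \<open>k > 0\<close>, \<open>C = M / k\<close> has trace one, and \<open>(u\<^sub>i\<^sup>T C u\<^sub>i)\<^sub>i\<close> is a point of the theta body: for \<open>C = c c\<^sup>T\<close> with a unit
  vector \<open>c\<close> this is the classical point with coordinates \<open>(c \<bullet> u\<^sub>i)\<^sup>2\<close> given by the orthonormal
  representation \<open>u\<close> with handle \<open>c\<close>, and a general \<open>C\<close> is a convex combination of such matrices.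
  Instead of decomposing \<open>C\<close>, \<open>orthogonal_representation_in_TH\<close> writes down the certificate directly.
\<close>

section \<open>Square roots of positive semidefinite matrices\<close>

lemma symmetric_matrix_inner:
  fixes A :: "real^'n^'n"
  assumes "transpose A = A"
  shows "x \<bullet> (A *v y) = (A *v x) \<bullet> y"
  by (metis assms dot_lmul_matrix transpose_matrix_vector)

text \<open>
  A null vector \<open>u\<close> of the form minimises it, so the first-order term of
  \<open>t \<mapsto> (u + t *\<^sub>R v) \<bullet> (A *v (u + t *\<^sub>R v))\<close> at \<open>t = 0\<close> vanishes for every \<open>v\<close>. For
  \<open>v = A *v u\<close> its coefficient is twice the squared norm of \<open>A *v u\<close>.
\<close>

lemma psd_null_vector:
  assumes "psd A" and null: "u \<bullet> (A *v u) = 0"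
  shows "A *v u = 0"
proof (rule ccontr)
  define v where "v = A *v u"
  define a where "a = v \<bullet> v"
  define b where "b = v \<bullet> (A *v v)"
  assume "A *v u \<noteq> 0"
  then have "a > 0" by (simp add: a_def v_def)
  have "b \<ge> 0" using assms(1) by (simp add: b_def psd_def)
  have uv: "u \<bullet> (A *v v) = a"
    using assms(1) by (simp add: symmetric_matrix_inner psd_def a_def v_def)
  have form: "0 \<le> 2 * t * a + t * t * b" for t
  proof -
    have "0 \<le> (u + t *\<^sub>R v) \<bullet> (A *v (u + t *\<^sub>R v))"
      using assms(1) by (simp add: psd_def)
    also have "\<dots> = 2 * t * a + t * t * b"
      using null uv
      by (simp add: matrix_vector_right_distrib matrix_vector_mult_scaleR inner_add_left
          inner_add_right v_def[symmetric] a_def[symmetric] b_def[symmetric] algebra_simps)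
    finally show ?thesis .
  qed
  \<comment> \<open>The minimiser \<open>t = - a / b\<close> of this quadratic, shifted so that \<open>b = 0\<close> is covered as well.\<close>
  have "0 \<le> 2 * (- (a / (b + 1))) * a + (- (a / (b + 1))) * (- (a / (b + 1))) * b"
    by (rule form)
  also have "\<dots> = - (a * a * (b + 2)) / ((b + 1) * (b + 1))"
    using \<open>b \<ge> 0\<close> by (simp add: divide_simps) (simp add: algebra_simps)
  also have "\<dots> < 0"
    using \<open>a > 0\<close> \<open>b \<ge> 0\<close> by (intro divide_neg_pos) auto
  finally show False by simp
qed

text \<open>
  A maximiser \<open>u\<close> of the quadratic form on the unit sphere, with maximum \<open>l\<close>, is a null vector of the
  positive semidefinite matrix \<open>l I - A\<close>.
\<close>

lemma psd_positive_eigenvector: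
  fixes A :: "real^'n^'n"
  assumes "psd A" "A \<noteq> 0"
  obtains u l where "norm u = 1" "l > 0" "A *v u = l *\<^sub>R u"
proof -
  have "continuous_on (sphere 0 1) (\<lambda>x. x \<bullet> (A *v x))"
    by (intro continuous_intros matrix_vector_mult_linear_continuous_on)
  moreover have "axis undefined 1 \<in> sphere (0::real^'n) 1" by simp
  then have "sphere (0::real^'n) 1 \<noteq> {}" by blast
  ultimately obtain u where u: "norm u = 1"
    and max: "\<And>x. norm x = 1 \<Longrightarrow> x \<bullet> (A *v x) \<le> u \<bullet> (A *v u)"
    using continuous_attains_sup[OF compact_sphere, of 0 1 "\<lambda>x. x \<bullet> (A *v x)"] by auto
  define l where "l = u \<bullet> (A *v u)"
  have bound: "x \<bullet> (A *v x) \<le> l * (x \<bullet> x)" for x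
  proof (cases "x = 0")
    case False
    then have "(x /\<^sub>R norm x) \<bullet> (A *v (x /\<^sub>R norm x)) \<le> l"
      unfolding l_def by (intro max) simp
    then have "x \<bullet> (A *v x) \<le> l * (norm x * norm x)"
      using False by (simp add: matrix_vector_mult_scaleR field_simps)
    then show ?thesis by (simp add: dot_square_norm power2_eq_square)
  qed simp
  have scaled: "(l *\<^sub>R mat 1 - A) *v x = l *\<^sub>R x - A *v x" for x
    by (simp add: matrix_vector_mult_diff_rdistrib scaleR_matrix_vector_assoc[symmetric])
  have "psd (l *\<^sub>R mat 1 - A)"
    unfolding psd_def scaled
    using bound psd_sym[OF assms(1)]
    by (simp add: inner_diff_right transpose_def vec_eq_iff mat_def)
  then have "(l *\<^sub>R mat 1 - A) *v u = 0"
    by (rule psd_null_vector)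
      (use u in \<open>simp add: scaled inner_diff_right l_def[symmetric] dot_square_norm\<close>)
  then have eigen: "A *v u = l *\<^sub>R u" by (simp add: scaled)
  have "l \<noteq> 0"
  proof
    assume "l = 0"
    then have "x \<bullet> (A *v x) = 0" for x
      using bound[of x] assms(1) by (simp add: psd_def antisym)
    then have "A *v x = 0" for x by (intro psd_null_vector[OF assms(1)])
    with assms(2) show False by (simp add: matrix_eq)
  qed
  moreover have "l \<ge> 0" using assms(1) by (simp add: psd_def l_def)
  ultimately show thesis using that[OF u _ eigen] by simp
qed

definition outer :: "real^'n \<Rightarrow> real^'n^'n" where
  "outer u = (\<chi> i j. u $ i * u $ j)"

lemma outer_mult_vector: "outer u *v x = (u \<bullet> x) *\<^sub>R u"
  by (simp add: outer_def vec_eq_iff matrix_vector_mult_def inner_vec_def sum_distrib_left mult_ac)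

lemma transpose_outer: "transpose (outer u) = outer u"
  by (simp add: outer_def transpose_def vec_eq_iff mult.commute)

text \<open>
  Splitting off one positive eigenvalue enlarges the kernel, so this is an induction on its
  codimension. A symmetric square root of the remainder kills the eigenvector that was split off,
  because \<open>norm (Z *v u)\<close> squared is \<open>u \<bullet> (Z ** Z *v u)\<close>; hence no mixed products arise.
\<close>

lemma psd_has_symmetric_sqrt:
  fixes A :: "real^'n^'n"
  assumes "psd A"
  shows "\<exists>Z. transpose Z = Z \<and> Z ** Z = A"
  using assms
proof (induction "CARD('n) - dim {x. A *v x = 0}" arbitrary: A rule: less_induct)
  case less
  show ?case
  proof (cases "A = 0")
    case True
    then show ?thesis by (intro exI[of _ 0]) (simp add: transpose_def vec_eq_iff)
  next
    case False
    obtain u l where u: "norm u = 1" and l: "l > 0" and Au: "A *v u = l *\<^sub>R u"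
      by (rule psd_positive_eigenvector[OF less.prems False])
    have uu: "u \<bullet> u = 1" using u by (simp add: dot_square_norm)
    have sym: "transpose A = A" using less.prems by (simp add: psd_def)
    define B where "B = A - l *\<^sub>R outer u"
    have Bv: "B *v x = A *v x - (l * (u \<bullet> x)) *\<^sub>R u" for x
      by (simp add: B_def matrix_vector_mult_diff_rdistrib scaleR_matrix_vector_assoc[symmetric]
          outer_mult_vector)
    have Bu: "B *v u = 0" by (simp add: Bv Au uu)
    have symB: "transpose B = B"
      using psd_sym[OF less.prems]
      by (simp add: B_def outer_def transpose_def vec_eq_iff mult.commute)
    have "0 \<le> x \<bullet> (B *v x)" for x
    proof -
      define v where "v = x - (u \<bullet> x) *\<^sub>R u"
      have uv: "u \<bullet> v = 0" by (simp add: v_def inner_diff_right uu)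
      have x: "x = v + (u \<bullet> x) *\<^sub>R u" by (simp add: v_def)
      have Bx: "B *v x = B *v v"
        by (simp add: v_def matrix_vector_mult_diff_distrib matrix_vector_mult_scaleR Bu)
      have "x \<bullet> (B *v x) = (B *v x) \<bullet> x" by (rule inner_commute)
      also have "\<dots> = v \<bullet> (B *v x)"
        using Bx symmetric_matrix_inner[OF symB, of v x] by simp
      also have "\<dots> = v \<bullet> (A *v v)"
        unfolding Bx by (simp add: Bv inner_diff_right inner_commute[of v u] uv)
      also have "0 \<le> \<dots>" using less.prems by (simp add: psd_def)
      finally show ?thesis .
    qed
    then have psdB: "psd B" by (simp add: psd_def symB)
    have ker: "subspace {x. C *v x = 0}" for C :: "real^'n^'n"
      by (simp add: subspace_def matrix_vector_right_distrib matrix_vector_mult_scaleR)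
    have "{x. A *v x = 0} \<subseteq> {x. B *v x = 0}"
    proof
      fix x assume "x \<in> {x. A *v x = 0}"
      then have Ax: "A *v x = 0" by simp
      have "l * (u \<bullet> x) = 0"
        using symmetric_matrix_inner[OF sym, of u x] Ax Au by simp
      then show "x \<in> {x. B *v x = 0}" using Ax l by (simp add: Bv)
    qed
    moreover have "u \<notin> {x. A *v x = 0}" "u \<in> {x. B *v x = 0}"
      using Au Bu l u by auto
    ultimately have "{x. A *v x = 0} \<subset> {x. B *v x = 0}" by blast
    then have "dim {x. A *v x = 0} < dim {x. B *v x = 0}"
      by (intro dim_psubset) (simp add: span_eq_iff[THEN iffD2, OF ker])
    moreover have "dim {x. B *v x = 0} \<le> CARD('n)"
      using dim_subset_UNIV[of "{x. B *v x = 0}"] by simp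
    ultimately have "CARD('n) - dim {x. B *v x = 0} < CARD('n) - dim {x. A *v x = 0}"
      by linarith
    then obtain Z where Z: "transpose Z = Z" "Z ** Z = B"
      using less.hyps psdB by blast
    have "(Z *v u) \<bullet> (Z *v u) = u \<bullet> (B *v u)"
      using symmetric_matrix_inner[OF Z(1), of u "Z *v u"] Z(2)
      by (simp add: matrix_vector_mul_assoc)
    then have Zu: "Z *v u = 0" by (simp add: Bu)
    define R where "R = Z + sqrt l *\<^sub>R outer u"
    have Rv: "R *v x = Z *v x + (sqrt l * (u \<bullet> x)) *\<^sub>R u" for x
      by (simp add: R_def matrix_vector_mult_add_rdistrib scaleR_matrix_vector_assoc[symmetric]
          outer_mult_vector)
    have "R *v (R *v x) = A *v x" for x
    proof -
      have uZ: "u \<bullet> (Z *v x) = 0" using symmetric_matrix_inner[OF Z(1), of u x] Zu by simp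
      have "R *v (R *v x) = Z *v (Z *v x) + (sqrt l * (sqrt l * (u \<bullet> x))) *\<^sub>R u"
        by (simp add: Rv matrix_vector_right_distrib matrix_vector_mult_scaleR Zu uZ
            inner_add_right uu)
      also have "\<dots> = B *v x + (l * (u \<bullet> x)) *\<^sub>R u"
        using Z(2) l by (simp add: matrix_vector_mul_assoc mult.assoc[symmetric])
      finally show ?thesis by (simp add: Bv)
    qed
    then have "R ** R = A" by (simp add: matrix_eq matrix_vector_mul_assoc)
    moreover have "transpose R = R"
      using Z(1) transpose_outer[of u]
      by (simp add: R_def transpose_def vec_eq_iff)
    ultimately show ?thesis by blast
  qed
qed

section \<open>Points of the theta body from orthogonal representations\<close>

text \<open>
  This is a sum over \<open>l\<close> of matrices \<open>F\<^sup>T C F\<close>, where \<open>F\<close> has the columns \<open>f a l\<close>.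
\<close>

lemma psd_sum_congruence:
  fixes f :: "'a::finite \<Rightarrow> 'l::finite \<Rightarrow> real^'n"
  assumes "psd C"
  shows "psd (\<chi> a b. \<Sum>l\<in>UNIV. f a l \<bullet> (C *v f b l))"
  unfolding psd_def
proof (intro conjI allI)
  have "f a l \<bullet> (C *v f b l) = f b l \<bullet> (C *v f a l)" for a b l
    using assms symmetric_matrix_inner[of C "f a l" "f b l"] by (simp add: psd_def inner_commute)
  then show "transpose (\<chi> a b. \<Sum>l\<in>UNIV. f a l \<bullet> (C *v f b l))
      = (\<chi> a b. \<Sum>l\<in>UNIV. f a l \<bullet> (C *v f b l))"
    by (simp add: transpose_def vec_eq_iff)
  fix p :: "real^'a"
  define s where "s l = (\<Sum>a\<in>UNIV. p $ a *\<^sub>R f a l)" for l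
  have "C *v s l = (\<Sum>b\<in>UNIV. p $ b *\<^sub>R (C *v f b l))" for l
    unfolding s_def by (simp add: linear_sum[OF matrix_vector_mul_linear] matrix_vector_mult_scaleR)
  then have right: "y \<bullet> (C *v s l) = (\<Sum>b\<in>UNIV. p $ b * (y \<bullet> (C *v f b l)))" for y l
    by (simp add: inner_sum_right)
  have left: "s l \<bullet> y = (\<Sum>a\<in>UNIV. p $ a * (f a l \<bullet> y))" for y l
    by (simp add: s_def inner_sum_left)
  have "(\<Sum>l\<in>UNIV. s l \<bullet> (C *v s l))
      = (\<Sum>l\<in>UNIV. \<Sum>a\<in>UNIV. \<Sum>b\<in>UNIV. p $ a * (p $ b * (f a l \<bullet> (C *v f b l))))"
    by (simp only: left) (simp add: right sum_distrib_left)
  also have "\<dots> = (\<Sum>a\<in>UNIV. \<Sum>b\<in>UNIV. \<Sum>l\<in>UNIV. p $ a * (p $ b * (f a l \<bullet> (C *v f b l))))"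
    by (subst sum.swap, intro sum.cong refl, subst sum.swap) simp
  also have "\<dots> = p \<bullet> ((\<chi> a b. \<Sum>l\<in>UNIV. f a l \<bullet> (C *v f b l)) *v p)"
    by (simp add: inner_vec_def matrix_vector_mult_def sum_distrib_left sum_distrib_right mult_ac)
  finally show "0 \<le> p \<bullet> ((\<chi> a b. \<Sum>l\<in>UNIV. f a l \<bullet> (C *v f b l)) *v p)"
    using assms sum_nonneg[of UNIV "\<lambda>l. s l \<bullet> (C *v s l)"] by (simp add: psd_def)
qed

text \<open>
  For \<open>C = c c\<^sup>T\<close> the bordered matrix is the Gram matrix of \<open>c\<close> and the vectors \<open>(c \<bullet> u\<^sub>i) u\<^sub>i\<close>. Averaging
  over \<open>c\<close> gives the certificate \<open>Y\<^sub>i\<^sub>j = (u\<^sub>i \<bullet> u\<^sub>j) (u\<^sub>i\<^sup>T C u\<^sub>j)\<close>. The bordered matrix is then the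
  Gram matrix of the matrices \<open>I\<close> and \<open>u\<^sub>i u\<^sub>i\<^sup>T\<close> with respect to the form \<open>trace (A\<^sup>T C B)\<close>, which is a sum over the
  columns of \<open>A\<close> and \<open>B\<close> as in \<open>psd_sum_congruence\<close>.
\<close>

lemma orthogonal_representation_in_TH:
  fixes E :: "'v::finite set set" and u :: "'v \<Rightarrow> real^'n" and C :: "real^'n^'n"
  assumes "psd C" "trace C = 1"
    and unit: "\<And>i. u i = 0 \<or> norm (u i) = 1"
    and orth: "\<And>i j. {i, j} \<in> E \<Longrightarrow> u i \<bullet> u j = 0"
  shows "(\<chi> i. u i \<bullet> (C *v u i)) \<in> TH E"
proof -
  define x where "x = (\<chi> i. u i \<bullet> (C *v u i))"
  define Y where "Y = (\<chi> i j. (u i \<bullet> u j) * (u i \<bullet> (C *v u j)))"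
  \<comment> \<open>The \<open>l\<close>-th column of the identity matrix and of \<open>u\<^sub>i u\<^sub>i\<^sup>T\<close>, respectively.\<close>
  define f where "f a l = (case a of None \<Rightarrow> axis l 1 | Some i \<Rightarrow> u i $ l *\<^sub>R u i)"
    for a :: "'v option" and l :: 'n
  have swap: "y \<bullet> (C *v z) = z \<bullet> (C *v y)" for y z
    using assms(1) by (metis inner_commute psd_def symmetric_matrix_inner)
  have None_Some: "(\<Sum>l\<in>UNIV. axis l 1 \<bullet> (C *v (v $ l *\<^sub>R v))) = v \<bullet> (C *v v)" for v
    by (simp add: matrix_vector_mult_scaleR inner_axis') (simp add: inner_vec_def)
  have Some_None: "(\<Sum>l\<in>UNIV. (v $ l *\<^sub>R v) \<bullet> (C *v axis l 1)) = v \<bullet> (C *v v)" for v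
    using None_Some[of v] by (simp only: swap[of "_ *\<^sub>R v"])
  have Some_Some: "(\<Sum>l\<in>UNIV. (v $ l *\<^sub>R v) \<bullet> (C *v (y $ l *\<^sub>R y))) = (v \<bullet> y) * (v \<bullet> (C *v y))"
    for v y
    unfolding inner_vec_def[of v y]
    by (simp add: matrix_vector_mult_scaleR sum_distrib_left mult_ac)
  have "(\<Sum>l\<in>UNIV. f a l \<bullet> (C *v f b l)) = bordered x Y $ a $ b" for a b
  proof (cases a)
    case None
    then show ?thesis
      using assms(2) None_Some
      by (cases b) (simp_all add: f_def bordered_def x_def axis_quadratic_form trace_def)
  next
    case (Some i)
    then show ?thesis
      using Some_None Some_Some
      by (cases b) (simp_all only: f_def bordered_def x_def Y_def option.case vec_lambda_beta)
  qed
  then have "bordered x Y = (\<chi> a b. \<Sum>l\<in>UNIV. f a l \<bullet> (C *v f b l))"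
    by (simp add: vec_eq_iff)
  then have "psd (bordered x Y)" using psd_sum_congruence[OF assms(1)] by simp
  moreover have "transpose Y = Y"
    using swap[of "u _" "u _"] by (simp add: Y_def transpose_def vec_eq_iff inner_commute)
  moreover have "(u i \<bullet> u i) * (u i \<bullet> (C *v u i)) = u i \<bullet> (C *v u i)" for i
    using unit[of i] by (auto simp: dot_square_norm)
  then have "diagonal Y = x" by (simp add: diagonal_def Y_def x_def vec_eq_iff)
  moreover have "adjacency E * Y = 0"
    using orth by (auto simp: adjacency_def Y_def vec_eq_iff)
  ultimately show ?thesis unfolding x_def[symmetric] TH_def by blast
qed

text \<open>
  If the trace of \<open>M\<close> is zero, normalising \<open>M\<close> to trace one is impossible, but then \<open>M = 0\<close>.
\<close>

lemma orthogonal_representation_in_TH_k: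
  fixes E :: "'v::finite set set" and u :: "'v \<Rightarrow> real^'n" and M :: "real^'n^'n"
  assumes "psd M" "M \<preceq> mat 1"
    and unit: "\<And>i. u i = 0 \<or> norm (u i) = 1"
    and orth: "\<And>i j. {i, j} \<in> E \<Longrightarrow> u i \<bullet> u j = 0"
  shows "(\<chi> i. u i \<bullet> (M *v u i)) \<in> TH_k (trace M) E"
proof -
  define x where "x = (\<chi> i. u i \<bullet> (M *v u i))"
  have "u i \<bullet> (M *v u i) \<le> u i \<bullet> u i" for i
    using assms(2)
    by (simp add: loewner_le_def psd_def matrix_vector_mult_diff_rdistrib inner_diff_right)
  moreover have "u i \<bullet> u i \<le> 1" for i using unit[of i] by (auto simp: dot_square_norm)
  ultimately have box: "x $ i \<in> {0..1}" for i
    using assms(1) by (simp add: x_def psd_def) (meson order_trans)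
  have diag: "0 \<le> M $ i $ i" for i by (rule psd_diag[OF assms(1)])
  have "x \<in> (\<lambda>x. trace M *\<^sub>R x) ` TH E"
  proof (cases "trace M = 0")
    case True
    then have "M $ i $ i = 0" for i
      using diag by (simp add: trace_def sum_nonneg_eq_0_iff)
    then have "\<bar>M $ i $ j\<bar> \<le> 0" for i j by (intro psd_entry_bound[OF assms(1)]) simp
    then have M: "M = 0" by (simp add: vec_eq_iff)
    have "x = trace M *\<^sub>R 0" by (simp add: x_def M vec_eq_iff)
    then show ?thesis using zero_in_TH[of E] by (rule image_eqI)
  next
    case False
    then have pos: "trace M > 0"
      using sum_nonneg[of UNIV "\<lambda>i. M $ i $ i"] diag by (simp add: trace_def order_less_le)
    define C where "C = M /\<^sub>R trace M"
    have Cv: "C *v y = (M *v y) /\<^sub>R trace M" for y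
      by (simp add: C_def scaleR_matrix_vector_assoc[symmetric])
    have "psd C"
      using assms(1) pos unfolding psd_def Cv by (simp add: C_def transpose_def vec_eq_iff)
    moreover have "trace C = 1"
      using pos by (simp add: C_def trace_def sum_distrib_left[symmetric])
    ultimately have "(\<chi> i. u i \<bullet> (C *v u i)) \<in> TH E"
      using unit orth by (rule orthogonal_representation_in_TH)
    moreover have "x = trace M *\<^sub>R (\<chi> i. u i \<bullet> (C *v u i))"
      using pos by (simp add: x_def Cv vec_eq_iff)
    ultimately show ?thesis by blast
  qed
  then show ?thesis using box unfolding x_def[symmetric] TH_k_def by blast
qed

section \<open>The inequality\<close>

lemma trace_sqrt_columns:
  fixes M Z :: "real^'n^'n"
  assumes "transpose Z = Z"
  shows "trace (M ** (Z ** Z)) = (\<Sum>i\<in>UNIV. (Z *v axis i 1) \<bullet> (M *v (Z *v axis i 1)))"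
proof -
  have "trace (M ** (Z ** Z)) = trace (Z ** (M ** Z))"
    by (metis matrix_mul_assoc trace_mul_sym)
  also have "\<dots> = (\<Sum>i\<in>UNIV. axis i 1 \<bullet> ((Z ** (M ** Z)) *v axis i 1))"
    by (simp add: trace_def axis_quadratic_form)
  finally show ?thesis
    by (simp add: matrix_vector_mul_assoc[symmetric] symmetric_matrix_inner[OF assms])
qed

theorem theorem21:
  fixes E :: "'v::finite set set" and k :: real and w :: "real^'v"
  assumes "simple_graph E" and "0 \<le> k" and "\<forall>i. 0 \<le> w $ i"
  shows "phi k E w \<le> theta k E w"
  unfolding phi_def
proof (rule SUP_least, clarify)
  fix M Y :: "real^'v^'v"
  assume "(M, Y) \<in> phi_feasible k E w"
  then have M: "psd M" "M \<preceq> mat 1" "trace M = k"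
    and Y: "psd Y" "diagonal Y = w" "adjacency E * Y = 0"
    by (auto simp: phi_feasible_def)
  obtain Z where Z: "transpose Z = Z" "Z ** Z = Y"
    using psd_has_symmetric_sqrt[OF Y(1)] by blast
  define z where "z i = Z *v axis i 1" for i
  have zz: "z i \<bullet> z j = Y $ i $ j" for i j
    using axis_quadratic_form[of i 1 Y j 1] Z(2)
    by (simp add: z_def symmetric_matrix_inner[OF Z(1), symmetric] matrix_vector_mul_assoc)
  then have norm_z: "norm (z i) ^ 2 = w $ i" for i
    using Y(2) by (auto simp: dot_square_norm[symmetric] diagonal_def)
  \<comment> \<open>Division by zero yields \<open>u i = 0\<close> where \<open>w $ i = 0\<close>.\<close>
  define u where "u i = z i /\<^sub>R norm (z i)" for i
  define x where "x = (\<chi> i. u i \<bullet> (M *v u i))"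
  have "x \<in> TH_k k E"
    unfolding x_def M(3)[symmetric]
  proof (rule orthogonal_representation_in_TH_k[OF M(1,2)])
    show "u i = 0 \<or> norm (u i) = 1" for i by (cases "z i = 0") (simp_all add: u_def)
    show "u i \<bullet> u j = 0" if "{i, j} \<in> E" for i j
    proof -
      have "adjacency E $ i $ j * Y $ i $ j = 0"
        using Y(3) by (metis vector_mult_component zero_index)
      then show ?thesis using that by (simp add: u_def zz adjacency_def)
    qed
  qed
  moreover have "trace (M ** Y) = w \<bullet> x"
  proof -
    have "z i = norm (z i) *\<^sub>R u i" for i by (cases "z i = 0") (simp_all add: u_def)
    then have "z i \<bullet> (M *v z i) = norm (z i) * (norm (z i) * (u i \<bullet> (M *v u i)))" for i
      by (metis inner_scaleR_left inner_scaleR_right matrix_vector_mult_scaleR)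
    then have "z i \<bullet> (M *v z i) = w $ i * x $ i" for i
      by (simp add: norm_z[symmetric] x_def power2_eq_square)
    then show ?thesis
      using trace_sqrt_columns[OF Z(1), of M] Z(2) by (simp add: z_def inner_vec_def)
  qed
  ultimately show "ereal (trace (M ** Y)) \<le> theta k E w"
    unfolding theta_def by (auto intro: SUP_upper2)
qed

end
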